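(* Let $t=0$, $0<q<1$, $N\ge1$, $a_1,\dots,a_N>0$. Let $\{(W_k,V_k)\}_{k=1}^N$ be a nearest neighbor ($q$-Whittaker-)multivariate `dynamics' on interlacing arrays of depth $N$ satisfying: (L1) for each $k$, the jump rate $W_k(\lambda^{(k)},\lambda^{(k)}+\mathrm e_k\,|\,\lambda^{(k-1)})$ of the leftmost particle $\lambda^{(k)}_k$ does not depend on the coordinates of the particles $\lambda^{(m)}_j$, $1\le j\le m-1$, $1\le m\le N$, other than the leftmost ones; (L2) for each $k\ge2$, the probability $V_k(\lambda,\lambda+\mathrm e_k\,|\,\bar\nu-\bar{\mathrm e}_{k-1},\bar\nu)$ that $\lambda^{(k-1)}_{k-1}$ pulls $\lambda^{(k)}_k$ is zero. Then each of the leftmost particles $\lambda^{(k)}_k$, $k=1,\dots,N$, jumps to the right by one independently of others (i.e. its only moves are independent jumps, it has no triggered moves) at rate $$a_k\bigl(1-q^{\lambda^{(k-1)}_{k-1}-\lambda^{(k)}_k}\bigr)$$ (this rate is understood as $a_1$ for $k=1$). In particular the rate vanishes when $\lambda^{(k)}_k=\lambda^{(k-1)}_{k-1}$.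
   Context: **Signatures.** $\mathbb{GT}_k=\{\lambda\in\mathbb Z^k:\lambda_1\ge\dots\ge\lambda_k\}$, $\mathbb{GT}_0=\{\varnothing\}$, $|\lambda|=\sum\lambda_i$. $\bar\lambda\prec\lambda$ ($\bar\lambda\in\mathbb{GT}_{k-1},\lambda\in\mathbb{GT}_k$) means $\lambda_{i+1}\le\bar\lambda_i\le\lambda_i$, $1\le i\le k-1$. $\mathrm e_j$, $\bar{\mathrm e}_i$ are standard basis vectors of $\mathbb Z^k$, $\mathbb Z^{k-1}$. Interlacing arrays: $\lambda^{(1)}\prec\dots\prec\lambda^{(N)}$, $\lambda^{(k)}\in\mathbb{GT}_k$; the numbers $\lambda^{(k)}_j$ are particles, and a move (jump) increases a coordinate by one. **Macdonald quantities** (here with $t=0$). $(a;q)_\infty=\prod_{i\ge0}(1-aq^i)$, $f(u)=(tu;q)_\infty/(qu;q)_\infty$, $0^0=1$. For $\kappa\prec\nu$, $\nu\in\mathbb{GT}_m$: $\psi_{\nu/\kappa}=\prod_{1\le i\le j\le m-1}\frac{f(q^{\kappa_i-\kappa_j}t^{j-i})f(q^{\nu_i-\nu_{j+1}}t^{j-i})}{f(q^{\nu_i-\kappa_j}t^{j-i})f(q^{\kappa_i-\nu_{j+1}}t^{j-i})}$, and $\psi_{\nu/\kappa}=0$ if $\kappa\not\prec\nu$. For signatures $\mu,\mu+\mathrm e_j$: $\psi'_{\mu+\mathrm e_j/\mu}=\prod_{i=1}^{j-1}\frac{(1-q^{\mu_i-\mu_j}t^{j-i-1})(1-q^{\mu_i-\mu_j-1}t^{j-i+1})}{(1-q^{\mu_i-\mu_j}t^{j-i})(1-q^{\mu_i-\mu_j-1}t^{j-i})}$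 (zero if one of them is not a signature). $P_\lambda(a_1,\dots,a_k)=\sum_{\lambda^{(1)}\prec\dots\prec\lambda^{(k)}=\lambda}\prod_{i=1}^k\psi_{\lambda^{(i)}/\lambda^{(i-1)}}a_i^{|\lambda^{(i)}|-|\lambda^{(i-1)}|}$. $\Lambda^k_{k-1}(\lambda,\bar\lambda)=\frac{P_{\bar\lambda}(a_1,\dots,a_{k-1})}{P_\lambda(a_1,\dots,a_k)}\psi_{\lambda/\bar\lambda}a_k^{|\lambda|-|\bar\lambda|}$, $\Lambda^1_0\equiv 1$. $Q_k(\lambda,\lambda+\mathrm e_j)=\frac{P_{\lambda+\mathrm e_j}(a_1,\dots,a_k)}{P_\lambda(a_1,\dots,a_k)}\psi'_{\lambda+\mathrm e_j/\lambda}$, other off-diagonal entries $0$, $Q_k(\lambda,\lambda)=-\sum_{\nu\ne\lambda}Q_k(\lambda,\nu)$; $Q_0=0$. **`Dynamics'** (positivity not required). Real functions $W_k(\lambda,\nu|\bar\lambda)$ (rates of independent jumps at level $k$ from $\lambda$ to $\nu$ given level $k-1$ at $\bar\lambda$) and $V_k(\lambda,\nu|\bar\lambda,\bar\nu)$ (probabilities that a move $\bar\lambda\to\bar\nu$ at level $k-1$ triggers $\lambda\to\nu$ at level $k$), where $\bar\lambda\prec\lambda$, $\bar\nu=\bar\lambda$ or $\bar\lambda+\bar{\mathrm e}_i$, such that: both vanish unless $\nu=\lambda$ or $\nu=\lambda+\mathrm e_j$; $V_k=0$ unless $\bar\nu\prec\nu$, $W_k=0$ unless $\bar\lambda\prec\nu$;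 $\sum_\nu V_k(\lambda,\nu|\bar\lambda,\bar\nu)=1$; $V_k(\lambda,\nu|\bar\lambda,\bar\lambda)=1_{\lambda=\nu}$; $\sum_{\nu\ne\lambda}W_k(\lambda,\nu|\bar\lambda)=-W_k(\lambda,\lambda|\bar\lambda)$; and for all $\lambda,\nu,\bar\nu$ with $\bar\nu\prec\nu$ $$\sum_{\bar\lambda}V_k(\lambda,\nu|\bar\lambda,\bar\nu)\Lambda^k_{k-1}(\lambda,\bar\lambda)Q_{k-1}(\bar\lambda,\bar\nu)+W_k(\lambda,\nu|\bar\nu)\Lambda^k_{k-1}(\lambda,\bar\nu)=Q_k(\lambda,\nu)\Lambda^k_{k-1}(\nu,\bar\nu).$$ **Nearest neighbor:** for $\bar\nu\prec\lambda$ let $\mathscr F=\{j\in\{1,\dots,k\}:\lambda_j<\bar\nu_{j-1}\}$ ($\bar\nu_0=+\infty$), $\xi(i)=\max\{j\le i:j\in\mathscr F\}$; for all $k\ge2$, $\bar\nu\prec\lambda$ and $j$ with $j+1\in\mathscr F$, $V_k(\lambda,\lambda+\mathrm e_m|\bar\nu-\bar{\mathrm e}_j,\bar\nu)=0$ unless $m=j+1$ or $m=\xi(j)$. *)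

theory Defs
  imports Complex_Main "HOL-Analysis.Infinite_Products"
begin

(* A signature of length k is stored as a function on nat with the 1-based coordinates
   1, ..., k, equal to 0 at every other index, so that equality of signatures is equality
   of functions and GT 0 has the zero function as its only element. *)

type_synonym signature = "nat \<Rightarrow> int"

definition GT :: "nat \<Rightarrow> signature set" where
  "GT k = {l. (\<forall>i. i \<notin> {1..k} \<longrightarrow> l i = 0) \<and> (\<forall>i\<in>{1..<k}. l (Suc i) \<le> l i)}"

definition weight :: "nat \<Rightarrow> signature \<Rightarrow> int" where
  "weight k l = (\<Sum>i=1..k. l i)"

(* The vectors l + e_j and l - e_j; they need not be signatures. *)

definition incr :: "signature \<Rightarrow> nat \<Rightarrow> signature" where
  "incr l j = l(j := l j + 1)"

definition decr :: "signature \<Rightarrow> nat \<Rightarrow> signature" where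
  "decr l j = l(j := l j - 1)"

definition moves :: "nat \<Rightarrow> signature \<Rightarrow> signature set" where
  "moves k l = {n \<in> GT k. n = l \<or> (\<exists>j\<in>{1..k}. n = incr l j)}"

(* interlaces k b l, for k \<ge> 1: b is in GT (k - 1), l is in GT k, and b \<prec> l. *)

definition interlaces :: "nat \<Rightarrow> signature \<Rightarrow> signature \<Rightarrow> bool" where
  "interlaces k b l \<longleftrightarrow>
     b \<in> GT (k - 1) \<and> l \<in> GT k \<and> (\<forall>i\<in>{1..k-1}. l (i + 1) \<le> b i \<and> b i \<le> l i)"

(* X k is the k-th row of the array; the row X 0 is the empty signature, and rows beyond the
   depth are zero. *)

definition arrays :: "nat \<Rightarrow> (nat \<Rightarrow> signature) set" where
  "arrays N = {X. (\<forall>k\<le>N. X k \<in> GT k) \<and> (\<forall>k>N. X k = (\<lambda>_. 0)) \<and>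
                  (\<forall>k\<in>{1..N}. interlaces k (X (k - 1)) (X k))}"

definition q_poch_inf :: "real \<Rightarrow> real \<Rightarrow> real" where
  "q_poch_inf x q = (\<Prod>i. 1 - x * q ^ i)"

definition mac_f :: "real \<Rightarrow> real \<Rightarrow> real \<Rightarrow> real" where
  "mac_f q t u = q_poch_inf (t * u) q / q_poch_inf (q * u) q"

(* psi q t m n b is the coefficient psi_{n/b}, n in GT m; at t = 0 the convention 0^0 = 1 is
   that of the power function. *)

definition psi :: "real \<Rightarrow> real \<Rightarrow> nat \<Rightarrow> signature \<Rightarrow> signature \<Rightarrow> real" where
  "psi q t m n b =
     (if interlaces m b n
      then \<Prod>i=1..m-1. \<Prod>j=i..m-1.
             (mac_f q t (q powi (b i - b j) * t ^ (j - i)) *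
              mac_f q t (q powi (n i - n (j + 1)) * t ^ (j - i))) /
             (mac_f q t (q powi (n i - b j) * t ^ (j - i)) *
              mac_f q t (q powi (b i - n (j + 1)) * t ^ (j - i)))
      else 0)"

(* psi' q t k l j is the coefficient psi'_{(l + e_j)/l}, l in GT k. *)

definition psi' :: "real \<Rightarrow> real \<Rightarrow> nat \<Rightarrow> signature \<Rightarrow> nat \<Rightarrow> real" where
  "psi' q t k l j =
     (if l \<in> GT k \<and> incr l j \<in> GT k
      then \<Prod>i=1..<j.
             ((1 - q powi (l i - l j) * t ^ (j - i - 1)) *
              (1 - q powi (l i - l j - 1) * t ^ (j - i + 1))) /
             ((1 - q powi (l i - l j) * t ^ (j - i)) *
              (1 - q powi (l i - l j - 1) * t ^ (j - i)))
      else 0)"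

definition macP :: "real \<Rightarrow> real \<Rightarrow> (nat \<Rightarrow> real) \<Rightarrow> nat \<Rightarrow> signature \<Rightarrow> real" where
  "macP q t a k l =
     (\<Sum>X | X \<in> arrays k \<and> X k = l.
        \<Prod>i=1..k. psi q t i (X i) (X (i - 1)) *
                  a i powi (weight i (X i) - weight (i - 1) (X (i - 1))))"

(* The stochastic link from level k to level k - 1. *)

definition link ::
  "real \<Rightarrow> real \<Rightarrow> (nat \<Rightarrow> real) \<Rightarrow> nat \<Rightarrow> signature \<Rightarrow> signature \<Rightarrow> real" where
  "link q t a k l b =
     (if k = 1 then 1
      else macP q t a (k - 1) b / macP q t a k l * psi q t k l b *
             a k powi (weight k l - weight (k - 1) b))"

definition jump_rate ::
  "real \<Rightarrow> real \<Rightarrow> (nat \<Rightarrow> real) \<Rightarrow> nat \<Rightarrow> signature \<Rightarrow> nat \<Rightarrow> real" where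
  "jump_rate q t a k l j = macP q t a k (incr l j) / macP q t a k l * psi' q t k l j"

(* In the off-diagonal case at most one j satisfies n = l + e_j. *)

definition Qmat ::
  "real \<Rightarrow> real \<Rightarrow> (nat \<Rightarrow> real) \<Rightarrow> nat \<Rightarrow> signature \<Rightarrow> signature \<Rightarrow> real" where
  "Qmat q t a k l n =
     (if n = l then - (\<Sum>j=1..k. jump_rate q t a k l j)
      else (\<Sum>j | j \<in> {1..k} \<and> n = incr l j. jump_rate q t a k l j))"

(* Arguments: W l n b is the rate of l -> n given b one level below; V l n b c is the
   probability that b -> c triggers l -> n.  They are constrained only where b \<prec> l (and, for V,
   c is b or b + e_i).  As interlaces k b n and interlaces k c n require n to be in GT k, W and V
   vanish when n is not a signature.  The sums over all n, resp. all b, are taken over the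
   finite sets that carry the nonzero terms. *)

definition dynamics_level ::
  "real \<Rightarrow> real \<Rightarrow> (nat \<Rightarrow> real) \<Rightarrow> nat \<Rightarrow>
   (signature \<Rightarrow> signature \<Rightarrow> signature \<Rightarrow> real) \<Rightarrow>
   (signature \<Rightarrow> signature \<Rightarrow> signature \<Rightarrow> signature \<Rightarrow> real) \<Rightarrow> bool" where
  "dynamics_level q t a k W V \<longleftrightarrow>
     (\<forall>l b. interlaces k b l \<longrightarrow>
        (\<forall>n. n \<notin> moves k l \<longrightarrow> W l n b = 0) \<and>
        (\<forall>n. \<not> interlaces k b n \<longrightarrow> W l n b = 0) \<and>
        (\<Sum>n \<in> moves k l - {l}. W l n b) = - W l l b) \<and>
     (\<forall>l b. interlaces k b l \<longrightarrow>
        (\<forall>c \<in> moves (k - 1) b.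
           (\<forall>n. n \<notin> moves k l \<longrightarrow> V l n b c = 0) \<and>
           (\<forall>n. \<not> interlaces k c n \<longrightarrow> V l n b c = 0) \<and>
           (\<Sum>n \<in> moves k l. V l n b c) = 1) \<and>
        (\<forall>n. V l n b b = (if l = n then 1 else 0))) \<and>
     (\<forall>l \<in> GT k. \<forall>n \<in> GT k. \<forall>c. interlaces k c n \<longrightarrow>
        (\<Sum>b | interlaces k b l. V l n b c * link q t a k l b * Qmat q t a (k - 1) b c)
          + W l n c * link q t a k l c
        = Qmat q t a k l n * link q t a k n c)"

definition multivariate_dynamics ::
  "real \<Rightarrow> real \<Rightarrow> (nat \<Rightarrow> real) \<Rightarrow> nat \<Rightarrow>
   (nat \<Rightarrow> signature \<Rightarrow> signature \<Rightarrow> signature \<Rightarrow> real) \<Rightarrow>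
   (nat \<Rightarrow> signature \<Rightarrow> signature \<Rightarrow> signature \<Rightarrow> signature \<Rightarrow> real) \<Rightarrow> bool" where
  "multivariate_dynamics q t a N W V \<longleftrightarrow>
     (\<forall>k\<in>{1..N}. dynamics_level q t a k (W k) (V k))"

(* The disjunct j = 1 encodes the convention c 0 = +infinity. *)

definition free_set :: "nat \<Rightarrow> signature \<Rightarrow> signature \<Rightarrow> nat set" where
  "free_set k c l = {j \<in> {1..k}. j = 1 \<or> l j < c (j - 1)}"

definition xi :: "nat \<Rightarrow> signature \<Rightarrow> signature \<Rightarrow> nat \<Rightarrow> nat" where
  "xi k c l i = Max {j \<in> free_set k c l. j \<le> i}"

(* If c \<prec> l and j + 1 is in free_set k c l with j \<ge> 1, then c - e_j is a signature
   interlacing with l, so V is evaluated inside its domain. *)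

definition nearest_neighbor ::
  "nat \<Rightarrow> (nat \<Rightarrow> signature \<Rightarrow> signature \<Rightarrow> signature \<Rightarrow> signature \<Rightarrow> real) \<Rightarrow> bool" where
  "nearest_neighbor N V \<longleftrightarrow>
     (\<forall>k\<in>{2..N}. \<forall>l c. interlaces k c l \<longrightarrow>
        (\<forall>j\<in>{1..k-1}. j + 1 \<in> free_set k c l \<longrightarrow>
           (\<forall>m\<in>{1..k}. m \<noteq> j + 1 \<and> m \<noteq> xi k c l j \<longrightarrow>
              V k l (incr l m) (decr c j) c = 0)))"

end

theory Submission
  imports Defs
begin

text \<open>
  Read the main identity for the move \<open>\<lambda> \<rightarrow> \<lambda> + e\<^sub>k\<close>. The sum over the lower level has no nonzero term:
  for \<open>i < k - 1\<close> the nearest neighbor condition forbids \<open>\<lambda>\<^bsup>(k-1)\<^esup>\<^sub>i\<close> to move the leftmost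
  particle, as \<open>\<xi>(i) \<le> i < k\<close>, and for \<open>i = k - 1\<close> (L2) does. Hence the rate \<open>W\<^sub>k\<close> equals
  \<open>\<psi>'\<close> times \<open>a\<^sub>k\<close> times a ratio of two \<open>\<psi>\<close>'s, all Macdonald polynomials cancelling. At \<open>t = 0\<close>
  only the diagonal factors \<open>i = j\<close> of \<open>\<psi>\<close> survive, and the recursion of the \<open>q\<close>-Pochhammer symbol
  reduces the product to \<open>a\<^sub>k (1 - q\<^sup>m)\<close> with \<open>m\<close> the gap to the particle below.
\<close>

section \<open>The \<open>q\<close>-Pochhammer symbol and the function \<open>f\<close> at
  \<open>t = 0\<close>\<close>

lemma convergent_prod_q_poch:
  fixes x q :: real
  assumes "0 \<le> x" "x < 1" "0 < q" "q < 1"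
  shows "convergent_prod (\<lambda>i. 1 - x * q ^ i)" "\<And>i. 0 < 1 - x * q ^ i"
proof -
  have lt: "x * q ^ i < 1" for i
    using assms mult_left_le[of "q ^ i" x] power_le_one[of q i] by linarith
  then show "0 < 1 - x * q ^ i" for i by simp
  have "summable (\<lambda>i. \<bar>- (x * q ^ i)\<bar>)"
    using assms by (simp add: abs_mult summable_mult summable_geometric)
  moreover have "- (x * q ^ i) \<noteq> - 1" for i
    using lt[of i] by simp
  ultimately have "convergent_prod (\<lambda>i. 1 + - (x * q ^ i))"
    by (rule summable_imp_convergent_prod_real)
  then show "convergent_prod (\<lambda>i. 1 - x * q ^ i)" by simp
qed

lemma q_poch_inf_pos:
  assumes "0 \<le> x" "x < 1" "0 < q" "q < 1"
  shows "0 < q_poch_inf x q"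
  unfolding q_poch_inf_def using convergent_prod_q_poch[OF assms] by (rule less_0_prodinf)

lemma q_poch_inf_rec:
  assumes "0 \<le> x" "x < 1" "0 < q" "q < 1"
  shows "q_poch_inf x q = (1 - x) * q_poch_inf (q * x) q"
proof -
  have "q_poch_inf x q = (\<Prod>i. 1 - x * q ^ (i + 1)) * (\<Prod>i<1. 1 - x * q ^ i)"
    unfolding q_poch_inf_def
    using convergent_prod_q_poch[OF assms]
    by (intro prodinf_split_initial_segment) (auto simp: less_le)
  then show ?thesis by (simp add: q_poch_inf_def mult_ac)
qed

lemma mac_f_0: "mac_f q 0 u = 1 / q_poch_inf (q * u) q"
  by (simp add: mac_f_def q_poch_inf_def)

lemma mac_f_0_0: "mac_f q 0 0 = 1"
  by (simp add: mac_f_def q_poch_inf_def)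

lemma mac_f_0_pos:
  assumes "0 < q" "q < 1" "0 \<le> m"
  shows "0 < mac_f q 0 (q powi m)"
proof -
  have "q ^ Suc (nat m) < 1" using assms by (intro power_Suc_less_one) auto
  then show ?thesis
    using assms by (auto simp: mac_f_0 power_int_nonneg_exp intro!: q_poch_inf_pos)
qed

text \<open>At \<open>t = 0\<close>, \<open>f(u)\<close> is the reciprocal of the Pochhammer symbol
  at \<open>q * u\<close>; the recursion splits off its first factor. The bound
  \<open>1 \<le> m\<close> keeps \<open>1 - q powi m\<close> nonzero.\<close>

lemma mac_f_0_diff_1:
  assumes "0 < q" "q < 1" "1 \<le> m"
  shows "mac_f q 0 (q powi (m - 1)) = mac_f q 0 (q powi m) / (1 - q powi m)"
proof -
  have "q * q powi (m - 1) = q powi m"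
    using assms power_int_add[of q 1 "m - 1"] by simp
  moreover have "q powi m < 1"
    using assms by (simp add: power_int_nonneg_exp power_less_one_iff)
  ultimately show ?thesis
    using assms q_poch_inf_rec[of "q powi m" q] by (simp add: mac_f_0)
qed

section \<open>The coefficients \<open>psi\<close> and \<open>psi'\<close> at
  \<open>t = 0\<close>\<close>

text \<open>For \<open>i < j\<close> every argument of \<open>f\<close> contains
  \<open>0 ^ (j - i) = 0\<close>, and \<open>f(0) = 1\<close>. For \<open>j = i\<close> the power is
  \<open>0 ^ 0 = 1\<close>, and the first factor becomes \<open>f(1)\<close>.\<close>

lemma psi_0:
  assumes "interlaces m b n"
  shows "psi q 0 m n b =
    (\<Prod>i=1..m-1. mac_f q 0 1 * mac_f q 0 (q powi (n i - n (i + 1))) /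
       (mac_f q 0 (q powi (n i - b i)) * mac_f q 0 (q powi (b i - n (i + 1)))))"
proof -
  have diag: "(\<Prod>j=i..m-1. g j) = g i"
    if "i \<in> {1..m-1}" "\<And>j. i < j \<Longrightarrow> g j = 1" for i and g :: "nat \<Rightarrow> real"
  proof -
    have "prod g {i..m-1} = g i * prod g {Suc i..m-1}"
      using that(1) by (intro prod.atLeast_Suc_atMost) auto
    also have "prod g {Suc i..m-1} = 1" using that(2) by (intro prod.neutral) auto
    finally show ?thesis by simp
  qed
  show ?thesis
    unfolding psi_def if_P[OF assms]
  proof (intro prod.cong refl)
    fix i assume i: "i \<in> {1..m-1}"
    show "(\<Prod>j=i..m-1.
        mac_f q 0 (q powi (b i - b j) * 0 ^ (j - i)) *
        mac_f q 0 (q powi (n i - n (j + 1)) * 0 ^ (j - i)) /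
        (mac_f q 0 (q powi (n i - b j) * 0 ^ (j - i)) *
         mac_f q 0 (q powi (b i - n (j + 1)) * 0 ^ (j - i)))) =
      mac_f q 0 1 * mac_f q 0 (q powi (n i - n (i + 1))) /
        (mac_f q 0 (q powi (n i - b i)) * mac_f q 0 (q powi (b i - n (i + 1))))"
      by (subst diag[OF i]) (simp_all add: mac_f_0_0 power_0_left)
  qed
qed

lemma psi_0_pos:
  assumes "0 < q" "q < 1" "interlaces m b n"
  shows "0 < psi q 0 m n b"
proof -
  have "mac_f q 0 1 > 0" using mac_f_0_pos[of q 0] assms by simp
  moreover have "n (i + 1) \<le> b i" "b i \<le> n i" if "i \<in> {1..m-1}" for i
    using assms(3) that by (auto simp: interlaces_def)
  ultimately show ?thesis
    unfolding psi_0[OF assms(3)]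
    by (intro prod_pos divide_pos_pos mult_pos_pos ballI mac_f_0_pos assms)
       (auto intro: order_trans)
qed

text \<open>Of the four powers of \<open>t\<close> only \<open>t ^ (k - i - 1)\<close> can have
  exponent zero, and only at \<open>i = k - 1\<close>; all other factors are 1.\<close>

lemma psi'_0_last:
  assumes "l \<in> GT k" "incr l k \<in> GT k" "2 \<le> k"
  shows "psi' q 0 k l k = 1 - q powi (l (k - 1) - l k)"
proof -
  have "psi' q 0 k l k = (\<Prod>i=1..<k. if i = k - 1 then 1 - q powi (l (k - 1) - l k) else 1)"
    using assms unfolding psi'_def
    by (simp only: if_True simp_thms, intro prod.cong refl) (auto simp: power_0_left)
  also have "\<dots> = 1 - q powi (l (k - 1) - l k)"
    using assms by (subst prod.delta) auto
  finally show ?thesis .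
qed

text \<open>Only the factor \<open>i = k - 1\<close> of \<open>psi\<close> sees the last coordinate.
  Raising it lowers both gaps \<open>x\<close> and \<open>y\<close> below by one, which multiplies
  \<open>psi\<close> by \<open>(1 - q powi y) / (1 - q powi x)\<close>; \<open>psi'\<close> cancels
  the denominator.\<close>

lemma psi_0_incr_last:
  assumes q: "0 < q" "q < 1" and k: "2 \<le> k"
    and lb: "interlaces k b l" and nb: "interlaces k b (incr l k)"
  shows "psi' q 0 k l k * psi q 0 k (incr l k) b = (1 - q powi (b (k - 1) - l k)) * psi q 0 k l b"
proof -
  define F where "F m = mac_f q 0 (q powi m)" for m
  define r where "r n i = mac_f q 0 1 * F (n i - n (i + 1)) / (F (n i - b i) * F (b i - n (i + 1)))"
    for n i
  define n where "n = incr l k"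
  define R where "R = (\<Prod>i\<in>{1..k-1} - {k-1}. r l i)"
  have psi: "psi q 0 k l b = r l (k-1) * R" "psi q 0 k n b = r n (k-1) * R"
  proof -
    have "(\<Prod>i\<in>{1..k-1} - {k-1}. r n i) = R"
      unfolding R_def by (intro prod.cong) (auto simp: r_def n_def incr_def)
    moreover have "prod (r p) {1..k-1} = r p (k-1) * (\<Prod>i\<in>{1..k-1} - {k-1}. r p i)" for p
      using k by (intro prod.remove) auto
    ultimately show "psi q 0 k l b = r l (k-1) * R" "psi q 0 k n b = r n (k-1) * R"
      using psi_0[OF lb] psi_0[OF nb] by (simp_all add: r_def F_def n_def R_def)
  qed
  \<comment> \<open>The strict gap comes from interlacing after the jump. It gives
    \<open>x, y \<ge> 1\<close>, so no denominator vanishes.\<close>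
  have le: "l k + 1 \<le> b (k-1)" "b (k-1) \<le> l (k-1)"
    using nb lb k by (auto simp: interlaces_def incr_def dest!: bspec[of _ _ "k-1"])
  define x where "x = l (k-1) - l k"
  define y where "y = b (k-1) - l k"
  have xy: "1 \<le> x" "1 \<le> y" using le by (auto simp: x_def y_def)
  have small: "q powi m < 1" if "1 \<le> m" for m
    using that q power_less_one_iff[of q "nat m"] by (simp add: power_int_nonneg_exp)
  have pos: "F x > 0" "F y > 0" "F (l (k-1) - b (k-1)) > 0"
    using xy le q by (auto simp: F_def intro!: mac_f_0_pos)
  have F: "F (x - 1) = F x / (1 - q powi x)" "F (y - 1) = F y / (1 - q powi y)"
    using xy q by (simp_all add: F_def mac_f_0_diff_1)
  have "(1 - q powi x) * r n (k-1) = (1 - q powi y) * r l (k-1)"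
  proof -
    have rn: "r n (k-1) = mac_f q 0 1 * F (x - 1) / (F (l (k-1) - b (k-1)) * F (y - 1))"
      using k by (auto simp: r_def n_def incr_def x_def y_def algebra_simps)
    have rl: "r l (k-1) = mac_f q 0 1 * F x / (F (l (k-1) - b (k-1)) * F y)"
      using k by (simp add: r_def x_def y_def)
    show ?thesis
      unfolding rn rl F using small[OF xy(1)] small[OF xy(2)] pos by (simp add: divide_simps)
  qed
  moreover have "psi' q 0 k l k = 1 - q powi x"
    using lb nb k by (simp add: psi'_0_last x_def interlaces_def)
  ultimately show ?thesis
    unfolding psi n_def[symmetric] y_def[symmetric] by (simp add: mult.assoc[symmetric])
qed

section \<open>Finiteness and existence of arrays; positivity of the polynomials\<close>

lemma finite_interlaces: "finite {b. interlaces k b l}"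
proof (rule finite_subset)
  \<comment> \<open>The coordinates lie in different intervals; their union serves as one finite
    range for all of them.\<close>
  show "{b. interlaces k b l} \<subseteq>
    {b. \<forall>i. (i \<in> {1..k-1} \<longrightarrow> b i \<in> (\<Union>i\<in>{1..k-1}. {l (i + 1)..l i})) \<and>
            (i \<notin> {1..k-1} \<longrightarrow> b i = 0)}"
    by (auto simp: interlaces_def GT_def intro!: bexI)
  show "finite \<dots>"
    by (intro finite_set_of_finite_funs) auto
qed

lemma arrays_Suc_restrict:
  assumes "X \<in> arrays (Suc k)"
  shows "X(Suc k := (\<lambda>_. 0)) \<in> arrays k"
  using assms by (auto simp: arrays_def)

lemma arrays_Suc_extend:
  assumes "X \<in> arrays k" "interlaces (Suc k) (X k) l"
  shows "X(Suc k := l) \<in> arrays (Suc k)"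
  using assms by (auto simp: arrays_def interlaces_def le_Suc_eq)

text \<open>A sum over an infinite set is 0 by default, so positivity of \<open>macP\<close> rests
  on this.\<close>

lemma finite_arrays: "finite {X \<in> arrays k. X k = l}"
proof (induction k arbitrary: l)
  case 0
  have "{X \<in> arrays 0. X 0 = l} \<subseteq> {\<lambda>_ _. 0}"
  proof
    fix X assume "X \<in> {X \<in> arrays 0. X 0 = l}"
    then have "X j i = 0" for j i
      by (cases "j = 0") (auto simp: arrays_def GT_def)
    then show "X \<in> {\<lambda>_ _. 0}" by auto
  qed
  then show ?case by (rule finite_subset) simp
next
  case (Suc k)
  have "{X \<in> arrays (Suc k). X (Suc k) = l} \<subseteq>
    (\<lambda>X. X(Suc k := l)) ` (\<Union>b\<in>{b. interlaces (Suc k) b l}. {X \<in> arrays k. X k = b})"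
  proof
    fix X assume X: "X \<in> {X \<in> arrays (Suc k). X (Suc k) = l}"
    let ?Y = "X(Suc k := (\<lambda>_. 0))"
    have "?Y \<in> arrays k" "interlaces (Suc k) (?Y k) l" "X = ?Y(Suc k := l)"
      using X arrays_Suc_restrict[of X k] by (auto simp: arrays_def dest: bspec[of _ _ "Suc k"])
    then show "X \<in> (\<lambda>X. X(Suc k := l)) `
        (\<Union>b\<in>{b. interlaces (Suc k) b l}. {X \<in> arrays k. X k = b})"
      by blast
  qed
  then show ?case
    by (rule finite_subset) (intro finite_imageI finite_UN_I finite_interlaces Suc.IH)
qed

lemma arrays_nonempty:
  assumes "l \<in> GT k"
  shows "\<exists>X \<in> arrays k. X k = l"
  using assms
proof (induction k arbitrary: l)
  case 0
  then have "l = (\<lambda>_. 0)" by (auto simp: GT_def)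
  then show ?case by (intro bexI[of _ "\<lambda>_ _. 0"]) (auto simp: arrays_def GT_def)
next
  case (Suc k)
  \<comment> \<open>Dropping the last coordinate of a signature gives an interlacing one.\<close>
  let ?b = "l(Suc k := 0)"
  have b: "?b \<in> GT k" "interlaces (Suc k) ?b l"
    using Suc.prems by (auto simp: GT_def interlaces_def)
  obtain X where "X \<in> arrays k" "X k = ?b" using Suc.IH[OF b(1)] by blast
  then show ?case
    using arrays_Suc_extend[of X k l] b(2) by (intro bexI[of _ "X(Suc k := l)"]) auto
qed

lemma macP_0_pos:
  assumes "0 < q" "q < 1" "\<forall>i\<in>{1..k}. 0 < a i" "l \<in> GT k"
  shows "0 < macP q 0 a k l"
  unfolding macP_def
proof (intro sum_pos prod_pos ballI mult_pos_pos)
  show "finite {X. X \<in> arrays k \<and> X k = l}"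
    using finite_arrays[of k l] by simp
  show "{X. X \<in> arrays k \<and> X k = l} \<noteq> {}"
    using arrays_nonempty[OF assms(4)] by blast
  fix X i assume "X \<in> {X. X \<in> arrays k \<and> X k = l}" "i \<in> {1..k}"
  then show "0 < psi q 0 i (X i) (X (i - 1))"
    using assms by (intro psi_0_pos) (auto simp: arrays_def)
  show "0 < a i powi (weight i (X i) - weight (i - 1) (X (i - 1)))"
    using assms \<open>i \<in> {1..k}\<close> by (simp add: zero_less_power_int)
qed

section \<open>Jump rates and links along a move of the leftmost particle\<close>

lemma weight_incr: "j \<in> {1..k} \<Longrightarrow> weight k (incr l j) = weight k l + 1"
  unfolding weight_def incr_def by (subst (1 2) sum.remove[of _ j]) auto

lemma Qmat_incr:
  assumes "j \<in> {1..k}"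
  shows "Qmat q t a k l (incr l j) = jump_rate q t a k l j"
proof -
  have inj: "incr l j = incr l i \<longleftrightarrow> i = j" for i
    by (auto simp: incr_def fun_eq_iff)
  have "incr l j \<noteq> l" by (auto simp: incr_def fun_eq_iff)
  moreover have "{i. i \<in> {1..k} \<and> incr l j = incr l i} = {j}"
    using assms by (auto simp: inj)
  ultimately show ?thesis by (simp add: Qmat_def)
qed

lemma Qmat_eq_0:
  assumes "n \<in> GT k" "n \<notin> moves k l"
  shows "Qmat q t a k l n = 0"
proof -
  have "{j. j \<in> {1..k} \<and> n = incr l j} = {}" "n \<noteq> l"
    using assms by (auto simp: moves_def)
  then show ?thesis unfolding Qmat_def by (simp only: if_False sum.empty)
qed

text \<open>The polynomial of \<open>incr l k\<close> cancels between rate and link, the extra unit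
  of weight gives \<open>a k\<close>, and \<open>psi_0_incr_last\<close> gives the rest. Positivity
  of the link later permits division by it.\<close>

lemma jump_rate_link:
  assumes q: "0 < q" "q < 1" and a: "\<forall>i\<in>{1..k}. 0 < a i" and k: "2 \<le> k"
    and lb: "interlaces k b l" and nb: "interlaces k b (incr l k)"
  shows "jump_rate q 0 a k l k * link q 0 a k (incr l k) b =
    a k * (1 - q powi (b (k - 1) - l k)) * link q 0 a k l b"
    and "link q 0 a k l b > 0"
proof -
  define n where "n = incr l k"
  have GT: "l \<in> GT k" "n \<in> GT k" "b \<in> GT (k - 1)"
    using lb nb by (auto simp: interlaces_def n_def)
  have ak: "a k > 0" using a k by auto
  have P: "macP q 0 a k l > 0" "macP q 0 a k n > 0" "macP q 0 a (k - 1) b > 0"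
    using GT a by (auto intro!: macP_0_pos q)
  show "link q 0 a k l b > 0"
    using P k ak psi_0_pos[OF q lb] by (simp add: link_def zero_less_power_int)
  have w: "a k powi (weight k n - weight (k - 1) b) =
      a k * a k powi (weight k l - weight (k - 1) b)"
    using ak k power_int_add[of "a k" 1 "weight k l - weight (k - 1) b"]
    by (simp add: n_def weight_incr algebra_simps)
  have "jump_rate q 0 a k l k * link q 0 a k n b =
    macP q 0 a (k - 1) b / macP q 0 a k l * (psi' q 0 k l k * psi q 0 k n b) *
      (a k * a k powi (weight k l - weight (k - 1) b))"
    using P k by (simp add: jump_rate_def link_def w n_def[symmetric] del: One_nat_def)
  also have "psi' q 0 k l k * psi q 0 k n b = (1 - q powi (b (k - 1) - l k)) * psi q 0 k l b"
    using psi_0_incr_last[OF q k lb nb] by (simp add: n_def)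
  finally show "jump_rate q 0 a k l k * link q 0 a k (incr l k) b =
    a k * (1 - q powi (b (k - 1) - l k)) * link q 0 a k l b"
    using k by (simp add: link_def n_def)
qed

text \<open>A single array of depth 1 has top row \<open>p\<close>, so its polynomial is the
  monomial \<open>a 1 powi p 1\<close>; \<open>psi'\<close> is an empty product.\<close>

lemma jump_rate_level_1:
  assumes "0 < a 1" "0 < q" "q < 1" "l \<in> GT 1"
  shows "jump_rate q 0 a 1 l 1 = a 1"
proof -
  have n: "incr l 1 \<in> GT 1" using assms by (auto simp: GT_def incr_def)
  have eq: "macP q 0 a 1 p = a 1 powi p 1" if "p \<in> GT 1" for p
  proof -
    define X where "X = (\<lambda>_ _. 0)(1 :: nat := p)"
    have "{X. X \<in> arrays 1 \<and> X 1 = p} = {X}"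
    proof (intro equalityI subsetI)
      fix Y assume Y: "Y \<in> {X. X \<in> arrays 1 \<and> X 1 = p}"
      then have "Y j = X j" for j
        by (cases "j = 0"; cases "j = 1") (auto simp: X_def arrays_def GT_def fun_eq_iff)
      then show "Y \<in> {X}" by auto
    qed (use that in \<open>auto simp: X_def arrays_def GT_def interlaces_def le_Suc_eq\<close>)
    moreover have "interlaces 1 (X 0) p"
      using that by (auto simp: X_def interlaces_def GT_def)
    ultimately show ?thesis
      by (simp add: macP_def psi_def weight_def X_def)
  qed
  have "a 1 powi (l 1 + 1) = a 1 powi l 1 * a 1"
    using assms by (simp add: power_int_add)
  then show ?thesis
    using assms n eq[OF n] eq[OF assms(4)] by (simp add: jump_rate_def psi'_def incr_def)
qed

section \<open>Consequences of the axioms of the dynamics\<close>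

lemma dynamics_level_eq:
  assumes "dynamics_level q t a k W V" "l \<in> GT k" "interlaces k c n"
  shows "(\<Sum>b | interlaces k b l. V l n b c * link q t a k l b * Qmat q t a (k - 1) b c)
    + W l n c * link q t a k l c = Qmat q t a k l n * link q t a k n c"
proof -
  have "n \<in> GT k" using assms(3) by (simp add: interlaces_def)
  then show ?thesis using assms unfolding dynamics_level_def by blast
qed

lemma leftmost_not_triggered:
  assumes dyn: "multivariate_dynamics q t a N W V"
    and nn: "nearest_neighbor N V"
    and L2: "\<forall>k\<in>{2..N}. \<forall>l. \<forall>c\<in>GT (k - 1). interlaces k (decr c (k - 1)) l \<longrightarrow>
               V k l (incr l k) (decr c (k - 1)) c = 0"
    and k: "k \<in> {1..N}" and lb: "interlaces k b l" and c: "c \<in> moves (k - 1) b"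
  shows "V k l (incr l k) b c = 0"
proof -
  have lvl: "dynamics_level q t a k (W k) (V k)"
    using dyn k by (auto simp: multivariate_dynamics_def)
  have GTc: "c \<in> GT (k - 1)" using c by (simp add: moves_def)
  have V0: "V k l (incr l k) b c = 0" if "\<not> interlaces k c (incr l k)"
    using that lvl lb c unfolding dynamics_level_def by blast
  consider "c = b" | i where "i \<in> {1..k-1}" "c = incr b i"
    using c by (auto simp: moves_def)
  then show ?thesis
  proof cases
    case 1
    have "V k l n b b = (if l = n then 1 else 0)" for n
      using lvl lb unfolding dynamics_level_def by blast
    moreover have "l \<noteq> incr l k" by (auto simp: incr_def fun_eq_iff)
    ultimately show ?thesis using 1 by simp
  next
    case (2 i)
    have k2: "k \<in> {2..N}" using 2(1) k by auto
    have b: "decr c i = b" by (simp add: 2(2) decr_def incr_def)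
    show ?thesis
    proof (cases "i = k - 1")
      case True
      then show ?thesis using L2 k2 lb GTc b by metis
    next
      case False
      show ?thesis
      proof (cases "interlaces k c (incr l k)")
        case inter: True
        \<comment> \<open>The nearest neighbor condition needs \<open>c\<close> to interlace with
          \<open>l\<close>, not only with \<open>incr l k\<close>; lowering the last coordinate only
          relaxes its constraint.\<close>
        have lc: "interlaces k c l"
          unfolding interlaces_def
        proof (intro conjI ballI)
          show "c \<in> GT (k - 1)" "l \<in> GT k" using GTc lb by (auto simp: interlaces_def)
          fix j assume "j \<in> {1..k-1}"
          then show "l (j + 1) \<le> c j" "c j \<le> l j"
            using inter by (auto simp: interlaces_def incr_def split: if_splits dest!: bspec[of _ _ j])
        qed
        have "l (i + 1) \<le> b i" using lb 2(1) by (auto simp: interlaces_def)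
        \<comment> \<open>The particle \<open>b i\<close> moved, so
          \<open>l (i + 1) \<le> b i < c i\<close>.\<close>
        then have free: "i + 1 \<in> free_set k c l"
          using 2 by (auto simp: free_set_def incr_def)
        \<comment> \<open>Index 1 is always free, so the maximum defining \<open>xi\<close> is over
          a nonempty set and is at most \<open>i < k - 1\<close>.\<close>
        have "1 \<in> {j \<in> free_set k c l. j \<le> i}"
          using 2(1) by (auto simp: free_set_def)
        moreover have "finite {j \<in> free_set k c l. j \<le> i}" by simp
        ultimately have "xi k c l i \<in> {j \<in> free_set k c l. j \<le> i}"
          unfolding xi_def by (metis (no_types, lifting) Max_in empty_iff)
        then have "k \<noteq> xi k c l i" "k \<noteq> i + 1" "k \<in> {1..k}"
          using False 2(1) by auto
        then have "V k l (incr l k) (decr c i) c = 0"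
          using nn k2 lc 2(1) free unfolding nearest_neighbor_def by blast
        then show ?thesis by (simp add: b)
      qed (use V0 in blast)
    qed
  qed
qed

theorem proposition8p4:
  fixes q :: real and N :: nat and a :: "nat \<Rightarrow> real"
    and W :: "nat \<Rightarrow> signature \<Rightarrow> signature \<Rightarrow> signature \<Rightarrow> real"
    and V :: "nat \<Rightarrow> signature \<Rightarrow> signature \<Rightarrow> signature \<Rightarrow> signature \<Rightarrow> real"
  assumes "0 < q" and "q < 1" and "1 \<le> N"
    and "\<forall>k\<in>{1..N}. 0 < a k"
    and "multivariate_dynamics q 0 a N W V"
    and "nearest_neighbor N V"
    and L1: "\<forall>k\<in>{1..N}. \<forall>X\<in>arrays N. \<forall>Y\<in>arrays N. (\<forall>m\<in>{1..N}. X m m = Y m m) \<longrightarrow>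
               W k (X k) (incr (X k) k) (X (k - 1)) = W k (Y k) (incr (Y k) k) (Y (k - 1))"
    and L2: "\<forall>k\<in>{2..N}. \<forall>l. \<forall>c\<in>GT (k - 1). interlaces k (decr c (k - 1)) l \<longrightarrow>
               V k l (incr l k) (decr c (k - 1)) c = 0"
  shows "\<forall>k\<in>{1..N}. \<forall>l b. interlaces k b l \<longrightarrow>
           W k l (incr l k) b = (if k = 1 then a 1 else a k * (1 - q powi (b (k - 1) - l k))) \<and>
           (k \<ge> 2 \<and> l k = b (k - 1) \<longrightarrow> W k l (incr l k) b = 0) \<and>
           (\<forall>c\<in>moves (k - 1) b. V k l (incr l k) b c = 0)"
proof (intro ballI allI impI conjI)
  fix k l b
  assume k: "k \<in> {1..N}" and lb: "interlaces k b l"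
  define n where "n = incr l k"
  have lvl: "dynamics_level q 0 a k (W k) (V k)"
    using assms(5) k by (auto simp: multivariate_dynamics_def)
  have a: "\<forall>i\<in>{1..k}. 0 < a i" using assms(4) k by auto
  note untriggered = leftmost_not_triggered[OF assms(5,6) L2 k]
  then show "V k l (incr l k) b c = 0" if "c \<in> moves (k - 1) b" for c
    using lb that by blast
  have GT: "l \<in> GT k" "b \<in> GT (k - 1)" using lb by (auto simp: interlaces_def)
  have W: "W k l n b * link q 0 a k l b = jump_rate q 0 a k l k * link q 0 a k n b"
    if nb: "interlaces k b n"
  proof -
    \<comment> \<open>If \<open>d\<close> can move to \<open>b\<close>, then \<open>V\<close>
      vanishes; otherwise \<open>Qmat\<close> does.\<close>
    have "V k l n d b * link q 0 a k l d * Qmat q 0 a (k - 1) d b = 0" if "interlaces k d l" for d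
      using untriggered[OF that, of b] Qmat_eq_0[OF GT(2), of d] by (auto simp: n_def)
    then have "(\<Sum>d | interlaces k d l.
        V k l n d b * link q 0 a k l d * Qmat q 0 a (k - 1) d b) = 0"
      by (intro sum.neutral) auto
    then have "W k l n b * link q 0 a k l b = Qmat q 0 a k l n * link q 0 a k n b"
      using dynamics_level_eq[OF lvl GT(1) nb] by simp
    then show ?thesis using k by (simp add: n_def Qmat_incr)
  qed
  show rate: "W k l (incr l k) b =
    (if k = 1 then a 1 else a k * (1 - q powi (b (k - 1) - l k)))"
  proof (cases "k = 1")
    case True
    \<comment> \<open>Level 0 holds only the empty signature, so the jump is never blocked.\<close>
    have "interlaces k b n"
      using lb True by (auto simp: interlaces_def GT_def n_def incr_def)
    then show ?thesis
      using W jump_rate_level_1[of a q l] a assms(1,2) GT(1) True by (simp add: link_def n_def)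
  next
    case False
    then have k2: "2 \<le> k" using k by auto
    have "W k l n b = a k * (1 - q powi (b (k - 1) - l k))"
    proof (cases "interlaces k b n")
      case True
      then show ?thesis
        using W jump_rate_link[OF assms(1,2) a k2 lb] by (simp add: n_def)
    next
      \<comment> \<open>A blocked jump has rate 0 by the axioms. The formula agrees, since blocking
        forces \<open>b (k - 1) = l k\<close> and hence \<open>1 - q powi 0 = 0\<close>.\<close>
      case no_jump: False
      have le: "l (i + 1) \<le> b i" "b i \<le> l i" if "i \<in> {1..k-1}" for i
        using lb that by (auto simp: interlaces_def)
      have last: "l k \<le> b (k - 1)" "b (k - 1) \<le> l (k - 1)"
        using le[of "k - 1"] k2 by auto
      have "b (k - 1) = l k"
      proof (rule ccontr)
        assume "b (k - 1) \<noteq> l k"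
        then have less: "l k < b (k - 1)" using last by simp
        have "interlaces k b n"
          unfolding interlaces_def
        proof (intro conjI ballI)
          have "l k < l (k - 1)" using less last by simp
          then show "n \<in> GT k"
            using GT(1) k2 by (auto simp: GT_def n_def incr_def)
          fix i assume i: "i \<in> {1..k-1}"
          then show "n (i + 1) \<le> b i" "b i \<le> n i"
            using le[OF i] less by (auto simp: n_def incr_def)
        qed (fact GT(2))
        then show False using no_jump by blast
      qed
      moreover have "W k l n b = 0"
        using lvl lb no_jump unfolding dynamics_level_def by blast
      ultimately show ?thesis by simp
    qed
    then show ?thesis using False by (simp add: n_def)
  qed
  show "W k l (incr l k) b = 0" if "2 \<le> k \<and> l k = b (k - 1)"
    using that by (simp add: rate)
qed

end
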